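(* Let $G$ be a strongly countably complete strongly topological gyrogroup with a symmetric neighborhood base $\mathscr{U}$ at $0$. Then $G$ contains a closed, countably compact, admissible subgyrogroup $P$, which is an $L$-subgyrogroup (so that the quotient space $G/P$ is defined), such that the quotient space $G/P$ is metrizable and the canonical map $\pi:G\to G/P$, $\pi(a)=a\oplus P$, is closed.
   Context: $\mathbb{N}$ is the set of positive integers and $\omega=\{0,1,2,\dots\}$. All topological spaces are assumed Hausdorff. A gyrogroup is a set $G$ with a binary operation $\oplus$ such that: (G1) there is a unique $0\in G$ with $0\oplus a=a=a\oplus 0$ for all $a$; (G2) for each $x$ there is a unique $\ominus x\in G$ with $\ominus x\oplus x=0=x\oplus(\ominus x)$; (G3) for all $x,y\in G$ there is an automorphism $\mathrm{gyr}[x,y]$ of $(G,\oplus)$ with $x\oplus(y\oplus z)=(x\oplus y)\oplus\mathrm{gyr}[x,y](z)$ for all $z\in G$; (G4) $\mathrm{gyr}[x\oplus y,y]=\mathrm{gyr}[x,y]$ for all $x,y\in G$. A topological gyrogroup is a gyrogroup with a topology for which $\oplus:G\times G\to G$ is jointly continuous and $x\mapsto\ominus x$ is continuous. It is a strongly topological gyrogroup if there is a neighborhood base $\mathscr{U}$ of $0$ such that $\mathrm{gyr}[x,y](U)=U$ for all $U\in\mathscr{U}$ and $x,y\in G$; "with a symmetric neighborhood base $\mathscr{U}$ at $0$" means that such a base $\mathscr{U}$ is fixed and $\ominus U=U$ for all $U\in\mathscr{U}$. A space $X$ is strongly countably complete if there is a sequence $\{\gamma_n:n\in\mathbb{N}\}$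 of open coverings of $X$ such that every decreasing sequence $\{F_n:n\in\mathbb{N}\}$ of nonempty closed sets in $X$, with each $F_n$ contained in some element of $\gamma_n$, has nonempty intersection. A nonempty subset $H\subset G$ is a subgyrogroup if it is a gyrogroup under the inherited operation and $\mathrm{gyr}[a,b]$ restricts to an automorphism of $H$ for all $a,b\in H$. It is an $L$-subgyrogroup if moreover $\mathrm{gyr}[a,h](H)=H$ for all $a\in G$, $h\in H$. A subgyrogroup $H$ of a topological gyrogroup $G$ is admissible if there is a sequence $\{U_n:n\in\omega\}$ of open symmetric neighborhoods of $0$ with $U_{n+1}\oplus(U_{n+1}\oplus U_{n+1})\subset U_n$ for each $n\in\omega$ and $H=\bigcap_{n\in\omega}U_n$. For an $L$-subgyrogroup $H$ of $G$, the set $G/H=\{a\oplus H:a\in G\}$ of left cosets is a partition of $G$; it carries the quotient topology: $O\subset G/H$ is open iff $\pi^{-1}(O)$ is open in $G$, where $\pi(a)=a\oplus H$. *)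

theory Defs
  imports "HOL-Analysis.Analysis"
begin

definition gyro_automorphism :: "'a set \<Rightarrow> ('a \<Rightarrow> 'a \<Rightarrow> 'a) \<Rightarrow> ('a \<Rightarrow> 'a) \<Rightarrow> bool" where
  "gyro_automorphism G add f \<longleftrightarrow>
     bij_betw f G G \<and> (\<forall>x\<in>G. \<forall>y\<in>G. f (add x y) = add (f x) (f y))"

text \<open>The identity, the inverse map and the gyrations are parameters, but by the axioms they are
  determined on \<open>G\<close> by the operation. The functions are arbitrary outside \<open>G\<close>, so the equality of
  gyrations in the last axiom is pointwise on \<open>G\<close>.\<close>

locale gyrogroup =
  fixes G :: "'a set"
    and add :: "'a \<Rightarrow> 'a \<Rightarrow> 'a" (infixl "\<oplus>" 65)
    and zero :: 'a
    and neg :: "'a \<Rightarrow> 'a"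
    and gyr :: "'a \<Rightarrow> 'a \<Rightarrow> 'a \<Rightarrow> 'a"
  assumes add_closed: "x \<in> G \<Longrightarrow> y \<in> G \<Longrightarrow> x \<oplus> y \<in> G"
    and zero_closed: "zero \<in> G"
    and zero_neutral: "a \<in> G \<Longrightarrow> zero \<oplus> a = a \<and> a \<oplus> zero = a"
    and zero_unique: "e \<in> G \<Longrightarrow> \<forall>a\<in>G. e \<oplus> a = a \<and> a \<oplus> e = a \<Longrightarrow> e = zero"
    and neg_closed: "x \<in> G \<Longrightarrow> neg x \<in> G"
    and neg_inverse: "x \<in> G \<Longrightarrow> neg x \<oplus> x = zero \<and> x \<oplus> neg x = zero"
    and neg_unique: "x \<in> G \<Longrightarrow> y \<in> G \<Longrightarrow> y \<oplus> x = zero \<and> x \<oplus> y = zero \<Longrightarrow> y = neg x"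
    and gyr_automorphism: "x \<in> G \<Longrightarrow> y \<in> G \<Longrightarrow> gyro_automorphism G (\<oplus>) (gyr x y)"
    and gyr_assoc: "x \<in> G \<Longrightarrow> y \<in> G \<Longrightarrow> z \<in> G \<Longrightarrow> x \<oplus> (y \<oplus> z) = (x \<oplus> y) \<oplus> gyr x y z"
    and gyr_loop: "x \<in> G \<Longrightarrow> y \<in> G \<Longrightarrow> z \<in> G \<Longrightarrow> gyr (x \<oplus> y) y z = gyr x y z"

text \<open>The Hausdorff axiom is part of the notion: all spaces are assumed to be Hausdorff.\<close>

locale topological_gyrogroup = gyrogroup "topspace X" add zero neg gyr
  for X :: "'a topology"
    and add :: "'a \<Rightarrow> 'a \<Rightarrow> 'a" (infixl "\<oplus>" 65)
    and zero :: 'a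
    and neg :: "'a \<Rightarrow> 'a"
    and gyr :: "'a \<Rightarrow> 'a \<Rightarrow> 'a \<Rightarrow> 'a" +
  assumes Hausdorff: "Hausdorff_space X"
    and continuous_add: "continuous_map (prod_topology X X) X (\<lambda>(x, y). x \<oplus> y)"
    and continuous_neg: "continuous_map X X neg"

text \<open>The library's \<open>neighbourhood_base_at\<close> does not require every member of the family to be
  a neighbourhood of the point; the first conjunct does. Neighbourhoods need not be open.\<close>

definition nbhd_base :: "'a topology \<Rightarrow> 'a \<Rightarrow> 'a set set \<Rightarrow> bool" where
  "nbhd_base X x \<U> \<longleftrightarrow>
     (\<forall>U\<in>\<U>. U \<subseteq> topspace X \<and> (\<exists>V. openin X V \<and> x \<in> V \<and> V \<subseteq> U)) \<and>
     neighbourhood_base_at x (\<lambda>U. U \<in> \<U>) X"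

locale strongly_topological_gyrogroup = topological_gyrogroup X add zero neg gyr
  for X :: "'a topology"
    and add :: "'a \<Rightarrow> 'a \<Rightarrow> 'a" (infixl "\<oplus>" 65)
    and zero :: 'a
    and neg :: "'a \<Rightarrow> 'a"
    and gyr :: "'a \<Rightarrow> 'a \<Rightarrow> 'a \<Rightarrow> 'a" +
  fixes \<U> :: "'a set set"
  assumes nbhd_base_zero: "nbhd_base X zero \<U>"
    and gyr_invariant: "U \<in> \<U> \<Longrightarrow> x \<in> topspace X \<Longrightarrow> y \<in> topspace X \<Longrightarrow> gyr x y ` U = U"

definition strongly_countably_complete :: "'a topology \<Rightarrow> bool" where
  "strongly_countably_complete X \<longleftrightarrow>
     (\<exists>\<gamma> :: nat \<Rightarrow> 'a set set.
        (\<forall>n. (\<forall>C\<in>\<gamma> n. openin X C) \<and> \<Union>(\<gamma> n) = topspace X) \<and>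
        (\<forall>F :: nat \<Rightarrow> 'a set.
           decseq F \<and> (\<forall>n. closedin X (F n) \<and> F n \<noteq> {} \<and> (\<exists>C\<in>\<gamma> n. F n \<subseteq> C))
             \<longrightarrow> (\<Inter>n. F n) \<noteq> {}))"

text \<open>The analogue of \<open>countably_compact\<close> for \<open>'a topology\<close>, in the style of \<open>compactin\<close>.\<close>

definition countably_compactin :: "'a topology \<Rightarrow> 'a set \<Rightarrow> bool" where
  "countably_compactin X S \<longleftrightarrow>
     S \<subseteq> topspace X \<and>
     (\<forall>\<C>. countable \<C> \<and> (\<forall>C\<in>\<C>. openin X C) \<and> S \<subseteq> \<Union>\<C>
        \<longrightarrow> (\<exists>\<F>. finite \<F> \<and> \<F> \<subseteq> \<C> \<and> S \<subseteq> \<Union>\<F>))"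

definition subgyrogroup ::
  "'a set \<Rightarrow> ('a \<Rightarrow> 'a \<Rightarrow> 'a) \<Rightarrow> ('a \<Rightarrow> 'a \<Rightarrow> 'a \<Rightarrow> 'a) \<Rightarrow> 'a set \<Rightarrow> bool" where
  "subgyrogroup G add gyr H \<longleftrightarrow>
     H \<subseteq> G \<and> H \<noteq> {} \<and>
     (\<exists>zero' neg' gyr'. gyrogroup H add zero' neg' gyr') \<and>
     (\<forall>a\<in>H. \<forall>b\<in>H. gyro_automorphism H add (gyr a b))"

definition L_subgyrogroup ::
  "'a set \<Rightarrow> ('a \<Rightarrow> 'a \<Rightarrow> 'a) \<Rightarrow> ('a \<Rightarrow> 'a \<Rightarrow> 'a \<Rightarrow> 'a) \<Rightarrow> 'a set \<Rightarrow> bool" where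
  "L_subgyrogroup G add gyr H \<longleftrightarrow>
     subgyrogroup G add gyr H \<and> (\<forall>a\<in>G. \<forall>h\<in>H. gyr a h ` H = H)"

definition set_add :: "('a \<Rightarrow> 'a \<Rightarrow> 'a) \<Rightarrow> 'a set \<Rightarrow> 'a set \<Rightarrow> 'a set" where
  "set_add add A B = {add a b | a b. a \<in> A \<and> b \<in> B}"

definition admissible_subgyrogroup ::
  "'a topology \<Rightarrow> ('a \<Rightarrow> 'a \<Rightarrow> 'a) \<Rightarrow> 'a \<Rightarrow> ('a \<Rightarrow> 'a) \<Rightarrow> ('a \<Rightarrow> 'a \<Rightarrow> 'a \<Rightarrow> 'a) \<Rightarrow> 'a set \<Rightarrow> bool"
where
  "admissible_subgyrogroup X add zero neg gyr H \<longleftrightarrow>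
     subgyrogroup (topspace X) add gyr H \<and>
     (\<exists>U :: nat \<Rightarrow> 'a set.
        (\<forall>n. openin X (U n) \<and> zero \<in> U n \<and> neg ` U n = U n) \<and>
        (\<forall>n. set_add add (U (Suc n)) (set_add add (U (Suc n)) (U (Suc n))) \<subseteq> U n) \<and>
        H = (\<Inter>n. U n))"

definition left_coset :: "('a \<Rightarrow> 'a \<Rightarrow> 'a) \<Rightarrow> 'a set \<Rightarrow> 'a \<Rightarrow> 'a set" where
  "left_coset add H a = add a ` H"

definition left_cosets :: "'a set \<Rightarrow> ('a \<Rightarrow> 'a \<Rightarrow> 'a) \<Rightarrow> 'a set \<Rightarrow> 'a set set" where
  "left_cosets G add H = left_coset add H ` G"

definition quotient_topology ::
  "'a topology \<Rightarrow> ('a \<Rightarrow> 'a \<Rightarrow> 'a) \<Rightarrow> 'a set \<Rightarrow> 'a set topology" where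
  "quotient_topology X add H =
     topology (\<lambda>W. W \<subseteq> left_cosets (topspace X) add H \<and>
                   openin X {a \<in> topspace X. left_coset add H a \<in> W})"

lemma openin_quotient_topology:
  "openin (quotient_topology X add H) W \<longleftrightarrow>
     W \<subseteq> left_cosets (topspace X) add H \<and>
     openin X {a \<in> topspace X. left_coset add H a \<in> W}"
proof -
  let ?P = "\<lambda>W. W \<subseteq> left_cosets (topspace X) add H \<and>
                openin X {a \<in> topspace X. left_coset add H a \<in> W}"
  have "istopology ?P"
    unfolding istopology_def
  proof (intro conjI allI impI)
    fix S T assume S: "?P S" and T: "?P T"
    have "{a \<in> topspace X. left_coset add H a \<in> S \<inter> T} =
          {a \<in> topspace X. left_coset add H a \<in> S} \<inter> {a \<in> topspace X. left_coset add H a \<in> T}"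
      by auto
    then show "openin X {a \<in> topspace X. left_coset add H a \<in> S \<inter> T}"
      using S T by auto
    show "S \<inter> T \<subseteq> left_cosets (topspace X) add H" using S by auto
  next
    fix \<K> assume K: "\<forall>S\<in>\<K>. ?P S"
    have "{a \<in> topspace X. left_coset add H a \<in> \<Union>\<K>} =
          (\<Union>S\<in>\<K>. {a \<in> topspace X. left_coset add H a \<in> S})"
      by auto
    then show "openin X {a \<in> topspace X. left_coset add H a \<in> \<Union>\<K>}"
      using K by auto
    show "\<Union>\<K> \<subseteq> left_cosets (topspace X) add H" using K by auto
  qed
  then show ?thesis
    unfolding quotient_topology_def by (simp add: topology_inverse')
qed

lemma topspace_quotient_topology:
  "topspace (quotient_topology X add H) = left_cosets (topspace X) add H"
proof -
  have "{a \<in> topspace X. left_coset add H a \<in> left_cosets (topspace X) add H} = topspace X"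
    by (auto simp: left_cosets_def)
  then have "openin (quotient_topology X add H) (left_cosets (topspace X) add H)"
    by (simp add: openin_quotient_topology)
  then show ?thesis
    by (meson openin_quotient_topology openin_subset openin_topspace subset_antisym)
qed

end

theory Submission
  imports Defs
begin

text \<open>
  Choose open symmetric gyration-invariant neighbourhoods \<open>W n\<close> of \<open>zero\<close> with
  \<open>W (Suc n) \<oplus> (W (Suc n) \<oplus> W (Suc n)) \<subseteq> W n\<close>, each inside a member of the \<open>n\<close>-th covering of
  the completeness hypothesis, and let \<open>P\<close> be their intersection. These inclusions and the
  invariance make \<open>P\<close> an admissible L-subgyrogroup. A decreasing sequence of nonempty closed sets
  \<open>F n \<subseteq> W n\<close> has nonempty intersection; with \<open>F n \<subseteq> P\<close> this is countable compactness of \<open>P\<close>.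

  The same completeness shows that the sets \<open>x \<oplus> W n\<close> form a neighbourhood base of the whole coset
  \<open>x \<oplus> P\<close> (\<open>coset_neighbourhood_base\<close>): a closed set that meets every \<open>x \<oplus> W n\<close> can be translated to
  \<open>zero\<close>, where completeness produces a common point with \<open>P\<close>. Closedness of the
  canonical map is an immediate consequence.

  For metrizability, consider the relations \<open>neg x \<oplus> y \<in> W n\<close>. The identities
  \<open>neg (neg x \<oplus> y) = gyr (neg x) y (neg y \<oplus> x)\<close> and
  \<open>neg x \<oplus> z = (neg x \<oplus> y) \<oplus> gyr (neg x) y (neg y \<oplus> z)\<close> differ from those of a group only by
  gyrations, which preserve \<open>W n\<close>. Hence the relations are a countable base of a uniformity, just
  as for a group, and Frink's chain construction (\<open>pseudometric_of_entourages\<close>) yields a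
  pseudometric. It vanishes exactly within cosets, and by the neighbourhood base property the metric
  that it induces on the cosets has the quotient topology.
\<close>

section \<open>A pseudometric from a sequence of entourages\<close>

definition chain_sums :: "('a \<Rightarrow> 'a \<Rightarrow> real) \<Rightarrow> 'a \<Rightarrow> 'a \<Rightarrow> real set" where
  "chain_sums f x y = {(\<Sum>i<n. f (g i) (g (Suc i))) | g n. g 0 = x \<and> g n = y}"

text \<open>Frink's lemma. Take the last point up to which at most half of the total length \<open>S\<close> has been
  used, and the link that starts there. The parts of the chain before and after this link both have
  length at most \<open>S / 2\<close>, so by induction the ends of each part are at \<open>f\<close>-distance at most \<open>S\<close>, as
  are the ends of the link itself. The quasi-ultrametric inequality then bounds the whole by \<open>2 * S\<close>.\<close>

lemma frink_chain_bound:
  fixes f :: "'a \<Rightarrow> 'a \<Rightarrow> real"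
  assumes nonneg: "\<And>x y. 0 \<le> f x y"
    and diag: "\<And>x. f x x = 0"
    and quasi: "\<And>x y z w. f x w \<le> 2 * max (f x y) (max (f y z) (f z w))"
  shows "m \<le> n \<Longrightarrow> f (g m) (g n) \<le> 2 * (\<Sum>i\<in>{m..<n}. f (g i) (g (Suc i)))"
proof (induction "n - m" arbitrary: m n rule: less_induct)
  case less
  let ?s = "\<lambda>a b. \<Sum>i\<in>{a..<b}. f (g i) (g (Suc i))"
  let ?S = "?s m n"
  show ?case
  proof (cases "m = n")
    case True
    then show ?thesis by (simp add: diag)
  next
    case False
    with less.prems have mn: "m < n" by simp
    have S0: "0 \<le> ?s a b" for a b by (simp add: sum_nonneg nonneg)
    define K where "K = {k. m \<le> k \<and> k < n \<and> ?s m k \<le> ?S / 2}"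
    have "finite K" unfolding K_def by (rule finite_subset[of _ "{..n}"]) auto
    moreover have "m \<in> K" using mn S0[of m n] by (simp add: K_def)
    ultimately have "Max K \<in> K" and upper: "\<And>j. j \<in> K \<Longrightarrow> j \<le> Max K"
      by (auto intro: Max_in)
    then obtain k where k: "m \<le> k" "k < n" "?s m k \<le> ?S / 2" and k_max: "k = Max K"
      by (auto simp: K_def)
    have split: "?S = ?s m k + f (g k) (g (Suc k)) + ?s (Suc k) n"
    proof -
      have "?S = ?s m k + ?s k n"
        using k by (simp add: sum.atLeastLessThan_concat)
      also have "?s k n = f (g k) (g (Suc k)) + ?s (Suc k) n"
        using k by (simp add: sum.atLeast_Suc_lessThan)
      finally show ?thesis by simp
    qed
    have tail: "?s (Suc k) n \<le> ?S / 2"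
    proof (cases "Suc k < n")
      case True
      have "Suc k \<notin> K" using upper[of "Suc k"] k_max by auto
      then have "\<not> ?s m (Suc k) \<le> ?S / 2"
        using True le_SucI[OF k(1)] unfolding K_def by blast
      moreover have "?s m (Suc k) = ?s m k + f (g k) (g (Suc k))"
        using k by simp
      ultimately show ?thesis using split by linarith
    next
      case False
      then show ?thesis using S0[of m n] by simp
    qed
    have "f (g m) (g k) \<le> 2 * ?s m k"
      using less.hyps[of k m] k mn by simp
    then have a: "f (g m) (g k) \<le> ?S" using k by simp
    have "f (g (Suc k)) (g n) \<le> 2 * ?s (Suc k) n"
      using less.hyps[of n "Suc k"] k mn by simp
    then have c: "f (g (Suc k)) (g n) \<le> ?S" using tail by simp
    have b: "f (g k) (g (Suc k)) \<le> ?S" using split S0[of m k] S0[of "Suc k" n] by linarith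
    show ?thesis
      using quasi[of "g m" "g n" "g k" "g (Suc k)"] a b c by linarith
  qed
qed

lemma chain_sums_concat:
  assumes "s \<in> chain_sums f x y" "t \<in> chain_sums f y z"
  shows "s + t \<in> chain_sums f x z"
proof -
  obtain g n where g: "g 0 = x" "g n = y" "s = (\<Sum>i<n. f (g i) (g (Suc i)))"
    using assms(1) by (auto simp: chain_sums_def)
  obtain h m where h: "h 0 = y" "h m = z" "t = (\<Sum>i<m. f (h i) (h (Suc i)))"
    using assms(2) by (auto simp: chain_sums_def)
  define k where "k i = (if i \<le> n then g i else h (i - n))" for i
  have "(\<Sum>i<n+m. f (k i) (k (Suc i)))
      = (\<Sum>i<n. f (k i) (k (Suc i))) + (\<Sum>i<m. f (k (n+i)) (k (Suc (n+i))))"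
    by (induction m) (simp_all add: algebra_simps)
  also have "(\<Sum>i<n. f (k i) (k (Suc i))) = s"
    unfolding g by (rule sum.cong) (auto simp: k_def)
  also have "(\<Sum>i<m. f (k (n+i)) (k (Suc (n+i)))) = t"
    unfolding h
  proof (rule sum.cong)
    fix i
    show "f (k (n+i)) (k (Suc (n+i))) = f (h i) (h (Suc i))"
      using g h by (cases "i = 0") (auto simp: k_def Suc_diff_le)
  qed simp
  finally have "s + t = (\<Sum>i<n+m. f (k i) (k (Suc i)))" by simp
  moreover have "k 0 = x" "k (n+m) = z"
    using g h by (auto simp: k_def)
  ultimately show ?thesis unfolding chain_sums_def by blast
qed

lemma chain_sums_reverse:
  assumes sym: "\<And>x y. f x y = f y x" and "s \<in> chain_sums f x y"
  shows "s \<in> chain_sums f y x"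
proof -
  obtain g n where g: "g 0 = x" "g n = y" "s = (\<Sum>i<n. f (g i) (g (Suc i)))"
    using assms(2) by (auto simp: chain_sums_def)
  define k where "k i = g (n - i)" for i
  have "s = (\<Sum>i<n. f (g (n - Suc i)) (g (Suc (n - Suc i))))"
    unfolding g by (rule sum.nat_diff_reindex[symmetric])
  also have "\<dots> = (\<Sum>i<n. f (k i) (k (Suc i)))"
  proof (rule sum.cong)
    fix i assume "i \<in> {..<n}"
    then show "f (g (n - Suc i)) (g (Suc (n - Suc i))) = f (k i) (k (Suc i))"
      using sym[of "g (n - Suc i)"] by (simp add: k_def Suc_diff_Suc)
  qed simp
  finally show ?thesis
    unfolding chain_sums_def using g by (auto simp: k_def intro!: exI[of _ k] exI[of _ n])
qed

text \<open>The metrization lemma for uniformities with a countable base, in quantitative form. The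
  dyadic size \<open>f x y\<close> of the first entourage that misses \<open>(x, y)\<close> need not satisfy the triangle
  inequality; the infimum \<open>d\<close> of the lengths of chains does, and by Frink's lemma it lies between
  \<open>f / 2\<close> and \<open>f\<close>.\<close>

lemma pseudometric_of_entourages:
  fixes V :: "nat \<Rightarrow> 'a \<Rightarrow> 'a \<Rightarrow> bool"
  assumes refl: "\<And>n x. V n x x"
    and sym: "\<And>n x y. V n x y \<Longrightarrow> V n y x"
    and triple: "\<And>n x y z w. V (Suc n) x y \<Longrightarrow> V (Suc n) y z \<Longrightarrow> V (Suc n) z w \<Longrightarrow> V n x w"
  obtains d :: "'a \<Rightarrow> 'a \<Rightarrow> real"
  where "\<And>x y. 0 \<le> d x y" "\<And>x y. d x y = d y x" "\<And>x y z. d x z \<le> d x y + d y z"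
    and "\<And>n x y. V n x y \<Longrightarrow> d x y < (1/2)^n"
    and "\<And>n x y. d x y < (1/2)^(Suc n) \<Longrightarrow> V n x y"
proof -
  define f :: "'a \<Rightarrow> 'a \<Rightarrow> real" where
    "f x y = (if \<forall>n. V n x y then 0 else (1/2)^(LEAST n. \<not> V n x y))" for x y
  have anti: "V n x y" if "V m x y" "n \<le> m" for m n x y
    using that(2,1) by (induction rule: inc_induct) (use triple refl in blast)+
  have V_iff: "V n x y \<longleftrightarrow> f x y < (1/2)^n" for n x y
  proof (cases "\<forall>n. V n x y")
    case True
    then show ?thesis by (simp add: f_def)
  next
    case False
    define l where "l = (LEAST n. \<not> V n x y)"
    have l: "\<not> V l x y"
      unfolding l_def by (rule LeastI_ex) (use False in blast)
    have "V n x y" if "n < l" for n using that not_less_Least unfolding l_def by blast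
    then have "V n x y \<longleftrightarrow> n < l" using l anti by (meson not_le)
    moreover have "f x y = (1/2)^l" using False by (simp add: f_def l_def)
    moreover have "(1/2::real)^l < (1/2)^n \<longleftrightarrow> n < l"
      by (rule power_strict_decreasing_iff) auto
    ultimately show ?thesis by simp
  qed
  have nonneg: "0 \<le> f x y" for x y by (simp add: f_def)
  have f_le1: "f x y \<le> 1" for x y by (simp add: f_def power_le_one)
  have diag: "f x x = 0" for x using refl by (simp add: f_def)
  have fsym: "f x y = f y x" for x y
  proof -
    have "V n x y \<longleftrightarrow> V n y x" for n using sym by blast
    then show ?thesis by (simp add: f_def)
  qed
  have dyadic: "f x y = 0 \<or> (\<exists>n. f x y = (1/2)^n)" for x y by (auto simp: f_def)
  have quasi: "f x w \<le> 2 * max (f x y) (max (f y z) (f z w))" for x y z w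
  proof -
    define M where "M = max (f x y) (max (f y z) (f z w))"
    have le: "f x y \<le> M" "f y z \<le> M" "f z w \<le> M" by (auto simp: M_def)
    have step: "f x w < (1/2)^n" if "M < (1/2)^(Suc n)" for n
    proof -
      have "V (Suc n) x y" "V (Suc n) y z" "V (Suc n) z w"
        using that le V_iff by (meson le_less_trans)+
      then show ?thesis using triple V_iff by blast
    qed
    have "M = 0 \<or> (\<exists>n. M = (1/2)^n)" using dyadic unfolding M_def max_def by metis
    then show ?thesis
    proof
      assume M: "M = 0"
      have "f x w < (1/2)^n" for n using step[of n] M by simp
      then have "\<forall>n. V n x w" using V_iff by blast
      then show ?thesis using M M_def by (simp add: f_def)
    next
      assume "\<exists>n. M = (1/2)^n"
      then obtain n where M: "M = (1/2)^n" by blast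
      show ?thesis
      proof (cases "n < 2")
        case True
        then have "n = 0 \<or> n = 1" by auto
        then have "1 \<le> 2 * M" using M by auto
        then show ?thesis using f_le1[of x w] M_def by linarith
      next
        case False
        then obtain k where n: "n = Suc (Suc k)"
          by (metis Suc_leD less_2_cases_iff not0_implies_Suc)
        have "M < (1/2)^(Suc k)" unfolding M n by (rule power_strict_decreasing) auto
        then have Vk: "V k x w" using step V_iff by blast
        \<comment> \<open>The strict bound loses a factor of two, which the dyadic values of \<open>f\<close> give back.\<close>
        have "f x w \<le> (1/2)^(Suc k)"
        proof (cases "f x w = 0")
          case False
          then obtain j where j: "f x w = (1/2)^j" using dyadic by blast
          have "(1/2::real)^j < (1/2)^k" using Vk V_iff j by metis
          then have "k < j" by (simp add: power_strict_decreasing_iff)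
          then show ?thesis unfolding j by (intro power_decreasing) auto
        qed simp
        then show ?thesis using M n M_def by simp
      qed
    qed
  qed
  define d where "d x y = Inf (chain_sums f x y)" for x y
  have link: "f x y \<in> chain_sums f x y" for x y
    unfolding chain_sums_def
    by (rule CollectI, rule exI[of _ "\<lambda>i. if i = 0 then x else y"], rule exI[of _ 1]) auto
  have nonempty: "chain_sums f x y \<noteq> {}" for x y using link by blast
  have below: "f x y / 2 \<le> s" if "s \<in> chain_sums f x y" for s x y
  proof -
    obtain g n where g: "g 0 = x" "g n = y" "s = (\<Sum>i<n. f (g i) (g (Suc i)))"
      using \<open>s \<in> chain_sums f x y\<close> by (auto simp: chain_sums_def)
    have "f (g 0) (g n) \<le> 2 * (\<Sum>i\<in>{0..<n}. f (g i) (g (Suc i)))"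
      by (rule frink_chain_bound[OF nonneg diag quasi]) simp
    then show ?thesis using g by (simp add: lessThan_atLeast0)
  qed
  have bdd: "bdd_below (chain_sums f x y)" for x y using below by (meson bdd_belowI)
  have d_le: "d x y \<le> s" if "s \<in> chain_sums f x y" for s x y
    unfolding d_def using that bdd by (rule cInf_lower)
  have f_le: "f x y / 2 \<le> d x y" for x y
    unfolding d_def by (intro cInf_greatest nonempty below)
  have "0 \<le> d x y" for x y using f_le[of x y] nonneg[of x y] by linarith
  moreover have "d x y = d y x" for x y
  proof -
    have "chain_sums f x y = chain_sums f y x"
      using chain_sums_reverse[of f, OF fsym] by blast
    then show ?thesis by (simp add: d_def)
  qed
  moreover have "d x z \<le> d x y + d y z" for x y z
  proof -
    have "d x z - t \<le> d x y" if t: "t \<in> chain_sums f y z" for t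
      unfolding d_def[of x y]
    proof (rule cInf_greatest)
      fix s assume "s \<in> chain_sums f x y"
      then show "d x z - t \<le> s" using d_le[OF chain_sums_concat[OF _ t]] by fastforce
    qed (rule nonempty)
    then have "d x z - d x y \<le> t" if "t \<in> chain_sums f y z" for t using that by fastforce
    then have "d x z - d x y \<le> d y z"
      unfolding d_def[of y z] by (intro cInf_greatest nonempty)
    then show ?thesis by simp
  qed
  moreover have "d x y < (1/2)^n" if "V n x y" for n x y
    using that V_iff d_le[OF link] by (meson le_less_trans)
  moreover have "V n x y" if "d x y < (1/2)^(Suc n)" for n x y
  proof -
    have "f x y \<le> 2 * d x y" using f_le[of x y] by simp
    also have "\<dots> < (1/2)^n" using that by simp
    finally show ?thesis using V_iff by blast
  qed
  ultimately show thesis by (rule that)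
qed

section \<open>Gyrogroup algebra\<close>

context gyrogroup
begin

lemma gyr_closed: "x \<in> G \<Longrightarrow> y \<in> G \<Longrightarrow> z \<in> G \<Longrightarrow> gyr x y z \<in> G"
  using gyr_automorphism by (auto simp: gyro_automorphism_def bij_betw_def)

lemma inj_gyr: "x \<in> G \<Longrightarrow> y \<in> G \<Longrightarrow> inj_on (gyr x y) G"
  using gyr_automorphism by (auto simp: gyro_automorphism_def bij_betw_def)

lemma gyr_add:
  "x \<in> G \<Longrightarrow> y \<in> G \<Longrightarrow> a \<in> G \<Longrightarrow> b \<in> G \<Longrightarrow> gyr x y (a \<oplus> b) = gyr x y a \<oplus> gyr x y b"
  using gyr_automorphism by (auto simp: gyro_automorphism_def)

lemma neg_neg: "x \<in> G \<Longrightarrow> neg (neg x) = x"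
  by (metis neg_closed neg_inverse neg_unique)

text \<open>Expanding \<open>neg a \<oplus> (a \<oplus> b)\<close> by the gyroassociative law gives \<open>gyr (neg a) a b\<close>, and
  gyrations are injective.\<close>

lemma add_left_cancel:
  assumes "a \<in> G" "b \<in> G" "c \<in> G" "a \<oplus> b = a \<oplus> c"
  shows "b = c"
proof -
  have "gyr (neg a) a b = gyr (neg a) a c"
    using assms gyr_assoc[of "neg a" a] neg_closed neg_inverse zero_neutral gyr_closed by metis
  then show ?thesis using assms inj_gyr neg_closed by (metis inj_onD)
qed

text \<open>The gyration in the expansion of \<open>neg a \<oplus> (a \<oplus> b)\<close> equals \<open>gyr zero a\<close> by the loop
  property, and \<open>gyr zero a\<close> is the identity by left cancellation.\<close>

lemma neg_add_cancel:
  assumes "a \<in> G" "b \<in> G"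
  shows "neg a \<oplus> (a \<oplus> b) = b"
proof -
  have "a \<oplus> b = a \<oplus> gyr zero a b"
    using gyr_assoc[of zero a b] assms zero_closed zero_neutral add_closed by metis
  then have "gyr zero a b = b"
    using add_left_cancel assms gyr_closed zero_closed by metis
  moreover have "gyr zero a b = gyr (neg a) a b"
    using gyr_loop[of "neg a" a b] assms neg_closed neg_inverse by metis
  ultimately show ?thesis
    using gyr_assoc[of "neg a" a b] assms neg_closed neg_inverse zero_neutral by metis
qed

lemma add_neg_cancel: "a \<in> G \<Longrightarrow> b \<in> G \<Longrightarrow> a \<oplus> (neg a \<oplus> b) = b"
  using neg_add_cancel[of "neg a" b] by (simp add: neg_closed neg_neg)

lemma gyr_eq: "x \<in> G \<Longrightarrow> y \<in> G \<Longrightarrow> z \<in> G \<Longrightarrow> gyr x y z = neg (x \<oplus> y) \<oplus> (x \<oplus> (y \<oplus> z))"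
  by (simp add: gyr_assoc neg_add_cancel add_closed gyr_closed)

text \<open>This identity and the next make \<open>neg x \<oplus> y\<close> behave, up to gyrations, like the difference
  of two elements of a group. Both sides here are right inverses of \<open>neg x \<oplus> y\<close>.\<close>

lemma neg_add_gyr:
  assumes "x \<in> G" "y \<in> G"
  shows "neg (neg x \<oplus> y) = gyr (neg x) y (neg y \<oplus> x)"
proof -
  have "(neg x \<oplus> y) \<oplus> gyr (neg x) y (neg y \<oplus> x) = zero"
    using assms gyr_assoc[of "neg x" y "neg y \<oplus> x"] add_neg_cancel neg_closed neg_inverse add_closed
    by metis
  moreover have "(neg x \<oplus> y) \<oplus> neg (neg x \<oplus> y) = zero"
    using assms neg_closed neg_inverse add_closed by metis
  ultimately show ?thesis
    using assms by (metis add_left_cancel add_closed neg_closed gyr_closed)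
qed

lemma add_gyr_telescope:
  assumes "x \<in> G" "y \<in> G" "z \<in> G"
  shows "neg x \<oplus> z = (neg x \<oplus> y) \<oplus> gyr (neg x) y (neg y \<oplus> z)"
  using assms gyr_assoc[of "neg x" y "neg y \<oplus> z"] add_neg_cancel neg_closed add_closed by metis

end

section \<open>Topology of a topological gyrogroup\<close>

context topological_gyrogroup
begin

lemma continuous_map_add2:
  assumes "continuous_map Y X f" "continuous_map Y X g"
  shows "continuous_map Y X (\<lambda>x. f x \<oplus> g x)"
proof -
  have "continuous_map Y (prod_topology X X) (\<lambda>x. (f x, g x))"
    using assms by (simp add: continuous_map_pairedI)
  from continuous_map_compose[OF this continuous_add] show ?thesis by (simp add: o_def)
qed

lemma continuous_left_add: "a \<in> topspace X \<Longrightarrow> continuous_map X X (\<lambda>x. a \<oplus> x)"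
  by (intro continuous_map_add2) auto

lemma openin_left_translate:
  assumes "a \<in> topspace X" "openin X S"
  shows "openin X (add a ` S)"
proof -
  have "add a ` S = {x \<in> topspace X. neg a \<oplus> x \<in> S}"
  proof
    show "add a ` S \<subseteq> {x \<in> topspace X. neg a \<oplus> x \<in> S}"
      using assms openin_subset[OF assms(2)] by (auto simp: add_closed neg_add_cancel subset_iff)
    show "{x \<in> topspace X. neg a \<oplus> x \<in> S} \<subseteq> add a ` S"
      using assms(1) add_neg_cancel by (metis (no_types, lifting) imageI mem_Collect_eq subsetI)
  qed
  then show ?thesis
    using openin_continuous_map_preimage[OF continuous_left_add assms(2)] assms neg_closed by simp
qed

text \<open>Left translations are homeomorphisms, so gyrations are too: \<open>gyr x y\<close> is the composition
  of the translations by \<open>y\<close>, by \<open>x\<close> and by \<open>neg (x \<oplus> y)\<close>.\<close>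

lemma openin_gyr_image:
  assumes "x \<in> topspace X" "y \<in> topspace X" "openin X S"
  shows "openin X (gyr x y ` S)"
proof -
  have "gyr x y ` S = add (neg (x \<oplus> y)) ` add x ` add y ` S"
    unfolding image_image using assms openin_subset[OF assms(3)]
    by (intro image_cong) (auto simp: gyr_eq subset_iff)
  then show ?thesis using assms by (simp add: openin_left_translate neg_closed add_closed)
qed

lemma openin_neg_image:
  assumes "openin X S"
  shows "openin X (neg ` S)"
proof -
  have "neg ` S = {x \<in> topspace X. neg x \<in> S}"
    using openin_subset[OF assms] by (auto simp: neg_closed neg_neg subset_iff intro!: rev_image_eqI)
  then show ?thesis using openin_continuous_map_preimage[OF continuous_neg assms] by simp
qed

lemma exists_triple_sum_neighbourhood:
  assumes "openin X N" "zero \<in> N"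
  shows "\<exists>S. openin X S \<and> zero \<in> S \<and> set_add add S (set_add add S S) \<subseteq> N"
proof -
  have sum2: "\<exists>A. openin X A \<and> zero \<in> A \<and> (\<forall>a\<in>A. \<forall>b\<in>A. a \<oplus> b \<in> M)"
    if M: "openin X M" "zero \<in> M" for M
  proof -
    let ?Q = "{p \<in> topspace (prod_topology X X). (\<lambda>(x, y). x \<oplus> y) p \<in> M}"
    have "openin (prod_topology X X) ?Q"
      by (rule openin_continuous_map_preimage[OF continuous_add M(1)])
    moreover have "(zero, zero) \<in> ?Q"
      using M zero_closed zero_neutral by simp
    ultimately obtain A B where AB: "openin X A" "openin X B" "zero \<in> A" "zero \<in> B" "A \<times> B \<subseteq> ?Q"
      unfolding openin_prod_topology_alt by meson
    have "a \<oplus> b \<in> M" if "a \<in> A \<inter> B" "b \<in> A \<inter> B" for a b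
    proof -
      have "(a, b) \<in> ?Q" using that AB(5) by (intro subsetD[OF AB(5)]) simp
      then show ?thesis by simp
    qed
    then show ?thesis using AB by (intro exI[of _ "A \<inter> B"] conjI openin_Int) auto
  qed
  obtain A where A: "openin X A" "zero \<in> A" "\<forall>a\<in>A. \<forall>b\<in>A. a \<oplus> b \<in> N"
    using sum2[OF assms] by blast
  obtain B where B: "openin X B" "zero \<in> B" "\<forall>a\<in>B. \<forall>b\<in>B. a \<oplus> b \<in> A"
    using sum2[OF A(1,2)] by blast
  have "set_add add (A \<inter> B) (set_add add (A \<inter> B) (A \<inter> B)) \<subseteq> N"
    using A(3) B(3) unfolding set_add_def by blast
  then show ?thesis
    using A B by (intro exI[of _ "A \<inter> B"] conjI openin_Int) auto
qed

end

text \<open>The image of the interior is an open subset of \<open>U\<close>, and so is its preimage; both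
  therefore lie in the interior.\<close>

lemma image_interior_of_eq:
  assumes "\<And>S. openin X S \<Longrightarrow> openin X (f ` S)" and "f ` U = U" and "inj_on f (topspace X)"
    and "continuous_map X X f" and "U \<subseteq> topspace X"
  shows "f ` (X interior_of U) = X interior_of U"
proof
  show "f ` (X interior_of U) \<subseteq> X interior_of U"
    using assms(1)[OF openin_interior_of] assms(2) interior_of_subset[of X U]
    by (intro interior_of_maximal) auto
  let ?S = "{x \<in> topspace X. f x \<in> X interior_of U}"
  have "?S \<subseteq> U"
  proof
    fix x assume "x \<in> ?S"
    then have "x \<in> topspace X" "f x \<in> f ` U" using assms(2) interior_of_subset[of X U] by auto
    then show "x \<in> U" using assms(3,5) by (meson inj_on_image_mem_iff)
  qed
  moreover have "openin X ?S"
    using assms(4) by (rule openin_continuous_map_preimage) simp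
  ultimately have "?S \<subseteq> X interior_of U" by (rule interior_of_maximal)
  moreover have "X interior_of U \<subseteq> f ` ?S"
  proof
    fix y assume y: "y \<in> X interior_of U"
    then obtain x where "x \<in> U" "y = f x" using assms(2) interior_of_subset[of X U] by blast
    then show "y \<in> f ` ?S" using y assms(5) by auto
  qed
  ultimately show "X interior_of U \<subseteq> f ` (X interior_of U)" by blast
qed

text \<open>The members of the given base need not be open; their interiors are still symmetric and
  invariant, because inversion and gyrations are homeomorphisms.\<close>

lemma (in strongly_topological_gyrogroup) exists_invariant_neighbourhood:
  assumes sym: "\<forall>U\<in>\<U>. neg ` U = U" and N: "openin X N" "zero \<in> N"
  shows "\<exists>W. openin X W \<and> zero \<in> W \<and> W \<subseteq> N \<and> neg ` W = W \<and>
    (\<forall>x\<in>topspace X. \<forall>y\<in>topspace X. gyr x y ` W = W)"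
proof -
  obtain V U where VU: "openin X V" "U \<in> \<U>" "zero \<in> V" "V \<subseteq> U" "U \<subseteq> N"
    using nbhd_base_zero N unfolding nbhd_base_def neighbourhood_base_at_def by meson
  have U: "U \<subseteq> topspace X" using VU(5) openin_subset[OF N(1)] by blast
  let ?W = "X interior_of U"
  have "neg ` ?W = ?W"
    using sym VU(2) openin_neg_image continuous_neg U
    by (intro image_interior_of_eq) (auto intro: inj_on_inverseI[of _ neg] neg_neg)
  moreover have "gyr x y ` ?W = ?W" if "x \<in> topspace X" "y \<in> topspace X" for x y
  proof (rule image_interior_of_eq)
    have "continuous_map X X (\<lambda>z. neg (x \<oplus> y) \<oplus> (x \<oplus> (y \<oplus> z)))"
      using that by (intro continuous_map_add2) (auto simp: neg_closed add_closed)
    then show "continuous_map X X (gyr x y)"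
      by (rule continuous_map_eq) (simp add: gyr_eq that)
  qed (use that openin_gyr_image gyr_invariant VU(2) inj_gyr U in auto)
  moreover have "zero \<in> ?W" using VU interior_of_maximal by (metis subsetD)
  moreover have "?W \<subseteq> N" using interior_of_subset[of X U] VU by blast
  ultimately show ?thesis by (intro exI[of _ ?W]) auto
qed

section \<open>The subgyrogroup cut out by a chain of invariant neighbourhoods\<close>

text \<open>The last assumption is the form in which strong countable completeness enters: it holds as
  soon as each \<open>W n\<close> lies in a member of the \<open>n\<close>-th covering.\<close>

locale invariant_neighbourhood_chain = topological_gyrogroup X add zero neg gyr
  for X :: "'a topology"
    and add :: "'a \<Rightarrow> 'a \<Rightarrow> 'a" (infixl "\<oplus>" 65)
    and zero :: 'a
    and neg :: "'a \<Rightarrow> 'a"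
    and gyr :: "'a \<Rightarrow> 'a \<Rightarrow> 'a \<Rightarrow> 'a" +
  fixes W :: "nat \<Rightarrow> 'a set"
  assumes open_W: "openin X (W n)"
    and zero_in_W: "zero \<in> W n"
    and neg_W: "neg ` W n = W n"
    and gyr_W: "x \<in> topspace X \<Longrightarrow> y \<in> topspace X \<Longrightarrow> gyr x y ` W n = W n"
    and triple_W: "set_add add (W (Suc n)) (set_add add (W (Suc n)) (W (Suc n))) \<subseteq> W n"
    and complete_W: "decseq F \<Longrightarrow> (\<And>n. closedin X (F n)) \<Longrightarrow> (\<And>n. F n \<noteq> {}) \<Longrightarrow>
      (\<And>n. F n \<subseteq> W n) \<Longrightarrow> (\<Inter>n. F n) \<noteq> {}"
begin

definition core :: "'a set" where
  "core = (\<Inter>n. W n)"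

definition near :: "nat \<Rightarrow> 'a \<Rightarrow> 'a \<Rightarrow> bool" where
  "near n x y \<longleftrightarrow> neg x \<oplus> y \<in> W n"

lemma W_carrier: "x \<in> W n \<Longrightarrow> x \<in> topspace X"
  using open_W openin_subset by blast

lemma neg_in_W: "x \<in> W n \<Longrightarrow> neg x \<in> W n"
  using neg_W by blast

lemma gyr_in_W: "x \<in> topspace X \<Longrightarrow> y \<in> topspace X \<Longrightarrow> z \<in> W n \<Longrightarrow> gyr x y z \<in> W n"
  using gyr_W by blast

lemma W_add3: "a \<in> W (Suc n) \<Longrightarrow> b \<in> W (Suc n) \<Longrightarrow> c \<in> W (Suc n) \<Longrightarrow> a \<oplus> (b \<oplus> c) \<in> W n"
  using triple_W[of n] unfolding set_add_def by blast

lemma W_add: "a \<in> W (Suc n) \<Longrightarrow> b \<in> W (Suc n) \<Longrightarrow> a \<oplus> b \<in> W n"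
  using W_add3[of a n b zero] zero_in_W zero_neutral W_carrier by metis

lemma W_Suc_subset: "W (Suc n) \<subseteq> W n"
  using W_add[OF _ zero_in_W] zero_neutral W_carrier by (metis subsetI)

lemma near_refl: "x \<in> topspace X \<Longrightarrow> near n x x"
  by (simp add: near_def neg_inverse zero_in_W)

text \<open>Inversion changes \<open>neg x \<oplus> y\<close> into \<open>neg y \<oplus> x\<close> up to a gyration, and gyrations preserve
  each \<open>W n\<close>.\<close>

lemma near_sym:
  assumes "x \<in> topspace X" "y \<in> topspace X" "near n x y"
  shows "near n y x"
proof -
  have "neg (neg y \<oplus> x) \<in> W n"
    using assms neg_add_gyr[of y x] gyr_in_W neg_closed by (simp add: near_def)
  then have "neg (neg (neg y \<oplus> x)) \<in> W n" by (rule neg_in_W)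
  then show ?thesis using assms by (simp add: near_def neg_neg add_closed neg_closed)
qed

text \<open>Up to gyrations, which preserve \<open>W (Suc n)\<close>, the difference of the outer points is a sum
  of the three consecutive differences.\<close>

lemma near_triple:
  assumes "x \<in> topspace X" "y \<in> topspace X" "z \<in> topspace X" "w \<in> topspace X"
    and "near (Suc n) x y" "near (Suc n) y z" "near (Suc n) z w"
  shows "near n x w"
proof -
  have yw: "neg y \<oplus> w = (neg y \<oplus> z) \<oplus> gyr (neg y) z (neg z \<oplus> w)"
    using assms add_gyr_telescope by blast
  have "gyr (neg x) y (neg y \<oplus> w)
      = gyr (neg x) y (neg y \<oplus> z) \<oplus> gyr (neg x) y (gyr (neg y) z (neg z \<oplus> w))"
    unfolding yw using assms by (intro gyr_add) (auto simp: neg_closed add_closed gyr_closed)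
  then have "neg x \<oplus> w = (neg x \<oplus> y) \<oplus>
      (gyr (neg x) y (neg y \<oplus> z) \<oplus> gyr (neg x) y (gyr (neg y) z (neg z \<oplus> w)))"
    using assms add_gyr_telescope[of x y w] by simp
  also have "\<dots> \<in> W n"
    using assms by (intro W_add3 gyr_in_W) (auto simp: near_def neg_closed)
  finally show ?thesis by (simp add: near_def)
qed

lemma near_trans:
  "x \<in> topspace X \<Longrightarrow> y \<in> topspace X \<Longrightarrow> z \<in> topspace X \<Longrightarrow>
    near (Suc n) x y \<Longrightarrow> near (Suc n) y z \<Longrightarrow> near n x z"
  using near_triple near_refl by blast

lemma openin_near: "x \<in> topspace X \<Longrightarrow> openin X {y \<in> topspace X. near n x y}"
  unfolding near_def
  using openin_continuous_map_preimage[OF continuous_left_add open_W] neg_closed by blast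

text \<open>A point \<open>y\<close> of the closure is near some \<open>u \<in> W (Suc n)\<close>, and \<open>y = u \<oplus> (neg u \<oplus> y)\<close> is a
  sum of two elements of \<open>W (Suc n)\<close>.\<close>

lemma closure_W_subset: "X closure_of W (Suc n) \<subseteq> W n"
proof
  fix y assume "y \<in> X closure_of W (Suc n)"
  then have y: "y \<in> topspace X"
    and meets: "\<And>T. y \<in> T \<Longrightarrow> openin X T \<Longrightarrow> \<exists>u. u \<in> W (Suc n) \<and> u \<in> T"
    unfolding in_closure_of by blast+
  obtain u where u: "u \<in> W (Suc n)" "near (Suc n) y u"
    using meets[OF _ openin_near[of y "Suc n"]] y near_refl by auto
  have c: "u \<in> topspace X" using u W_carrier by blast
  have "near (Suc n) u y" using near_sym u y c by blast
  then have "u \<oplus> (neg u \<oplus> y) \<in> W n" using u W_add by (simp add: near_def)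
  then show "y \<in> W n" using c y by (simp add: add_neg_cancel)
qed

lemma core_carrier: "x \<in> core \<Longrightarrow> x \<in> topspace X"
  using W_carrier by (auto simp: core_def)

lemma zero_in_core: "zero \<in> core"
  by (simp add: core_def zero_in_W)

lemma closedin_core: "closedin X core"
proof -
  have "core = (\<Inter>n. X closure_of W (Suc n))"
  proof
    show "(\<Inter>n. X closure_of W (Suc n)) \<subseteq> core"
      unfolding core_def using closure_W_subset by blast
    have "W n \<subseteq> X closure_of W n" for n
      by (intro closure_of_subset openin_subset open_W)
    then show "core \<subseteq> (\<Inter>n. X closure_of W (Suc n))"
      unfolding core_def by blast
  qed
  then show ?thesis by (simp add: closedin_INT)
qed

lemma gyr_core: "x \<in> topspace X \<Longrightarrow> y \<in> topspace X \<Longrightarrow> gyr x y ` core = core"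
  unfolding core_def
  using inj_gyr[of x y] gyr_W W_carrier by (subst image_INT[of _ "topspace X"]) auto

lemma core_add: "a \<in> core \<Longrightarrow> b \<in> core \<Longrightarrow> a \<oplus> b \<in> core"
  using W_add by (auto simp: core_def)

lemma core_neg: "a \<in> core \<Longrightarrow> neg a \<in> core"
  using neg_in_W by (auto simp: core_def)

lemma gyro_automorphism_core:
  assumes "a \<in> topspace X" "b \<in> topspace X"
  shows "gyro_automorphism core add (gyr a b)"
  unfolding gyro_automorphism_def bij_betw_def
  using assms gyr_core gyr_add core_carrier inj_gyr[of a b]
  by (auto intro: inj_on_subset)

lemma subgyrogroup_core: "subgyrogroup (topspace X) add gyr core"
proof -
  have "gyrogroup core add zero neg gyr"
  proof
    show "e = zero" if "e \<in> core" "\<forall>a\<in>core. e \<oplus> a = a \<and> a \<oplus> e = a" for e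
      using that zero_in_core zero_neutral core_carrier by metis
  qed (use core_add core_neg zero_in_core zero_neutral neg_inverse neg_unique gyr_assoc gyr_loop
        gyro_automorphism_core core_carrier in auto)
  then show ?thesis
    unfolding subgyrogroup_def
    using core_carrier zero_in_core gyro_automorphism_core by blast
qed

lemma L_subgyrogroup_core: "L_subgyrogroup (topspace X) add gyr core"
  unfolding L_subgyrogroup_def using subgyrogroup_core gyr_core core_carrier by blast

lemma admissible_core: "admissible_subgyrogroup X add zero neg gyr core"
  unfolding admissible_subgyrogroup_def
  using subgyrogroup_core open_W zero_in_W neg_W triple_W core_def by blast

text \<open>Completeness is applied to the sets \<open>F n \<inter> X closure_of W (Suc n)\<close>, which are closed and
  contained in \<open>W n\<close>.\<close>

lemma complete_core:
  assumes "decseq F" and closed: "\<And>n. closedin X (F n)" and meets: "\<And>n. F n \<inter> W n \<noteq> {}"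
  shows "(\<Inter>n. F n) \<inter> core \<noteq> {}"
proof -
  let ?E = "\<lambda>n. F n \<inter> X closure_of W (Suc n)"
  have "decseq ?E"
    using \<open>decseq F\<close> W_Suc_subset closure_of_mono unfolding decseq_Suc_iff by (metis Int_mono)
  moreover have "closedin X (?E n)" for n by (intro closedin_Int closed) simp
  moreover have "?E n \<noteq> {}" for n
  proof -
    have "W (Suc n) \<subseteq> X closure_of W (Suc n)"
      by (intro closure_of_subset openin_subset open_W)
    moreover have "F (Suc n) \<subseteq> F n" using \<open>decseq F\<close> by (simp add: decseq_Suc_iff)
    ultimately show ?thesis using meets[of "Suc n"] by blast
  qed
  moreover have "?E n \<subseteq> W n" for n using closure_W_subset by blast
  ultimately have "(\<Inter>n. ?E n) \<noteq> {}" by (rule complete_W)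
  then show ?thesis unfolding core_def using closure_W_subset by blast
qed

text \<open>For a countable open cover without finite subcover, the parts of the core that the finite
  partial unions leave uncovered form a decreasing sequence of nonempty closed sets. By completeness
  they have a common point, which no member of the cover contains.\<close>

lemma countably_compactin_core: "countably_compactin X core"
  unfolding countably_compactin_def
proof (intro conjI allI impI)
  show "core \<subseteq> topspace X" using core_carrier by blast
next
  fix \<C> assume C: "countable \<C> \<and> (\<forall>C\<in>\<C>. openin X C) \<and> core \<subseteq> \<Union>\<C>"
  then have ne: "\<C> \<noteq> {}" using zero_in_core by blast
  show "\<exists>\<F>. finite \<F> \<and> \<F> \<subseteq> \<C> \<and> core \<subseteq> \<Union>\<F>"
  proof (rule ccontr)
    assume none: "\<not> ?thesis"
    let ?c = "from_nat_into \<C>"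
    define F where "F n = core - \<Union>(?c ` {..n})" for n
    have c: "?c n \<in> \<C>" for n using ne by (rule from_nat_into)
    have "F n \<noteq> {}" for n
    proof
      assume "F n = {}"
      then have "core \<subseteq> \<Union>(?c ` {..n})" by (auto simp: F_def)
      moreover have "finite (?c ` {..n})" "?c ` {..n} \<subseteq> \<C>" using c by auto
      ultimately show False using none by blast
    qed
    moreover have "F n \<subseteq> W n" for n by (auto simp: F_def core_def)
    moreover have "closedin X (F n)" for n
      unfolding F_def using closedin_core c C by (intro closedin_diff openin_Union) auto
    moreover have "decseq F" by (auto simp: decseq_Suc_iff F_def)
    ultimately have "(\<Inter>n. F n) \<noteq> {}" using complete_W by blast
    then obtain x where x: "\<And>n. x \<in> F n" by blast
    then have "x \<in> core" by (auto simp: F_def)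
    then obtain D where "D \<in> \<C>" "x \<in> D" using C by blast
    then obtain n where "x \<in> ?c n" using C by (metis from_nat_into_surj)
    then show False using x[of n] by (auto simp: F_def)
  qed
qed

section \<open>The quotient by the core\<close>

lemma in_coset_iff:
  assumes "a \<in> topspace X" "b \<in> topspace X"
  shows "b \<in> left_coset add core a \<longleftrightarrow> (\<forall>n. near n a b)"
proof -
  have "b \<in> left_coset add core a \<longleftrightarrow> neg a \<oplus> b \<in> core"
  proof
    assume "b \<in> left_coset add core a"
    then obtain u where "u \<in> core" "b = a \<oplus> u" by (auto simp: left_coset_def)
    then show "neg a \<oplus> b \<in> core" using assms core_carrier by (simp add: neg_add_cancel)
  next
    assume "neg a \<oplus> b \<in> core"
    then have "a \<oplus> (neg a \<oplus> b) \<in> left_coset add core a" by (simp add: left_coset_def)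
    then show "b \<in> left_coset add core a" using assms by (simp add: add_neg_cancel)
  qed
  then show ?thesis by (simp add: core_def near_def)
qed

lemma coset_carrier: "a \<in> topspace X \<Longrightarrow> b \<in> left_coset add core a \<Longrightarrow> b \<in> topspace X"
  unfolding left_coset_def using core_carrier add_closed by blast

lemma coset_self: "a \<in> topspace X \<Longrightarrow> a \<in> left_coset add core a"
  by (simp add: in_coset_iff near_refl)

lemma coset_eq_iff:
  assumes "a \<in> topspace X" "b \<in> topspace X"
  shows "left_coset add core a = left_coset add core b \<longleftrightarrow> (\<forall>n. near n a b)"
proof
  assume "left_coset add core a = left_coset add core b"
  then show "\<forall>n. near n a b" using in_coset_iff coset_self assms by blast
next
  assume ab: "\<forall>n. near n a b"
  have "c \<in> left_coset add core a \<longleftrightarrow> c \<in> left_coset add core b" for c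
  proof (cases "c \<in> topspace X")
    case True
    then show ?thesis using assms ab in_coset_iff near_trans near_sym by meson
  next
    case False
    then show ?thesis using assms coset_carrier by blast
  qed
  then show "left_coset add core a = left_coset add core b" by blast
qed

text \<open>If no \<open>x \<oplus> W n\<close> lies in \<open>S\<close>, then the complement of \<open>S\<close>, translated by \<open>neg x\<close>, is a
  closed set that meets every \<open>W n\<close>, so by completeness it meets the core: the coset of \<open>x\<close> leaves
  \<open>S\<close>.\<close>

lemma coset_neighbourhood_base:
  assumes x: "x \<in> topspace X" and S: "openin X S" "left_coset add core x \<subseteq> S"
  shows "\<exists>n. \<forall>y\<in>topspace X. near n x y \<longrightarrow> y \<in> S"
proof (rule ccontr)
  assume none: "\<not> ?thesis"
  define F where "F = {u \<in> topspace X. x \<oplus> u \<in> topspace X - S}"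
  have "closedin X F"
    unfolding F_def using S
    by (intro closedin_continuous_map_preimage[OF continuous_left_add[OF x]]) auto
  moreover have "F \<inter> W n \<noteq> {}" for n
  proof -
    obtain y where y: "y \<in> topspace X" "near n x y" "y \<notin> S" using none by blast
    then have "neg x \<oplus> y \<in> F \<inter> W n"
      using x by (auto simp: F_def near_def add_neg_cancel add_closed neg_closed)
    then show ?thesis by blast
  qed
  ultimately have "(\<Inter>n::nat. F) \<inter> core \<noteq> {}"
    by (intro complete_core) (auto simp: decseq_def)
  then obtain u where u: "u \<in> F" "u \<in> core" by blast
  then have "x \<oplus> u \<in> left_coset add core x" by (auto simp: left_coset_def)
  then show False using u S by (auto simp: F_def)
qed

text \<open>The preimage of a set of cosets contains the whole coset of each of its points, so if it is
  open, the neighbourhood base property applies.\<close>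

lemma openin_quotient_iff:
  "openin (quotient_topology X add core) Q \<longleftrightarrow> Q \<subseteq> left_cosets (topspace X) add core \<and>
    (\<forall>x\<in>topspace X. left_coset add core x \<in> Q \<longrightarrow>
      (\<exists>n. \<forall>y\<in>topspace X. near n x y \<longrightarrow> left_coset add core y \<in> Q))"
proof -
  let ?O = "{a \<in> topspace X. left_coset add core a \<in> Q}"
  have "openin X ?O \<longleftrightarrow> (\<forall>x\<in>topspace X. left_coset add core x \<in> Q \<longrightarrow>
      (\<exists>n. \<forall>y\<in>topspace X. near n x y \<longrightarrow> left_coset add core y \<in> Q))" (is "_ \<longleftrightarrow> ?R")
  proof
    assume op: "openin X ?O"
    show ?R
    proof (intro ballI impI)
      fix x assume x: "x \<in> topspace X" "left_coset add core x \<in> Q"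
      have "left_coset add core x \<subseteq> ?O"
      proof
        fix y assume y: "y \<in> left_coset add core x"
        then have "left_coset add core x = left_coset add core y" "y \<in> topspace X"
          using x coset_carrier coset_eq_iff in_coset_iff by blast+
        then show "y \<in> ?O" using x by simp
      qed
      then show "\<exists>n. \<forall>y\<in>topspace X. near n x y \<longrightarrow> left_coset add core y \<in> Q"
        using coset_neighbourhood_base[OF x(1) op] by blast
    qed
  next
    assume R: ?R
    show "openin X ?O"
      unfolding openin_subopen[of X ?O]
    proof
      fix x assume x: "x \<in> ?O"
      then obtain n where n: "\<forall>y\<in>topspace X. near n x y \<longrightarrow> left_coset add core y \<in> Q"
        using R by blast
      show "\<exists>T. openin X T \<and> x \<in> T \<and> T \<subseteq> ?O"
        using x n openin_near[of x n] near_refl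
        by (intro exI[of _ "{y \<in> topspace X. near n x y}"]) auto
    qed
  qed
  then show ?thesis by (simp add: openin_quotient_topology)
qed

text \<open>If the coset of \<open>x\<close> misses the closed set \<open>C\<close>, then so does some \<open>x \<oplus> W n\<close>, and no coset
  through a point of \<open>x \<oplus> W (Suc n)\<close> can reach \<open>C\<close>.\<close>

lemma closed_map_coset: "closed_map X (quotient_topology X add core) (left_coset add core)"
  unfolding closed_map_def
proof (intro allI impI)
  fix C assume C: "closedin X C"
  then have CX: "C \<subseteq> topspace X" by (rule closedin_subset)
  let ?\<pi> = "left_coset add core"
  let ?Q = "left_cosets (topspace X) add core - ?\<pi> ` C"
  have "openin (quotient_topology X add core) ?Q"
    unfolding openin_quotient_iff
  proof (intro conjI ballI impI)
    fix x assume x: "x \<in> topspace X" "?\<pi> x \<in> ?Q"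
    have "?\<pi> x \<subseteq> topspace X - C"
    proof
      fix y assume y: "y \<in> ?\<pi> x"
      then have "?\<pi> x = ?\<pi> y" "y \<in> topspace X"
        using x coset_carrier coset_eq_iff in_coset_iff by blast+
      then show "y \<in> topspace X - C" using x by auto
    qed
    then obtain n where n: "\<forall>y\<in>topspace X. near n x y \<longrightarrow> y \<in> topspace X - C"
      using coset_neighbourhood_base[OF x(1)] C by blast
    have "?\<pi> y \<in> ?Q" if y: "y \<in> topspace X" "near (Suc n) x y" for y
    proof -
      have "?\<pi> y \<noteq> ?\<pi> c" if "c \<in> C" for c
        using that n x(1) y CX coset_eq_iff[of y c] near_trans[of x y c n] by blast
      then show ?thesis using y by (auto simp: left_cosets_def)
    qed
    then show "\<exists>n. \<forall>y\<in>topspace X. near n x y \<longrightarrow> ?\<pi> y \<in> ?Q" by blast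
  qed auto
  moreover have "?\<pi> ` C \<subseteq> left_cosets (topspace X) add core"
    using CX by (auto simp: left_cosets_def)
  ultimately show "closedin (quotient_topology X add core) (?\<pi> ` C)"
    by (simp add: closedin_def topspace_quotient_topology)
qed

text \<open>The relations \<open>near n\<close> are a base of a uniformity whose pseudometric identifies exactly the
  points of a common coset, so it descends to a metric on cosets. That this metric induces the
  quotient topology, and not merely a coarser one, is the neighbourhood base property.\<close>

lemma metrizable_quotient: "metrizable_space (quotient_topology X add core)"
proof -
  let ?G = "topspace X" and ?\<pi> = "left_coset add core"
  let ?M = "left_cosets ?G add core"
  \<comment> \<open>The diagonal makes the relations reflexive outside of the carrier as well.\<close>
  define V where "V n x y \<longleftrightarrow> x = y \<or> (x \<in> ?G \<and> y \<in> ?G \<and> near n x y)" for n x y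
  have near_Suc: "near n x y" if "near (Suc n) x y" for n x y
    using that W_Suc_subset by (auto simp: near_def)
  obtain d :: "'a \<Rightarrow> 'a \<Rightarrow> real" where d: "\<And>x y. 0 \<le> d x y" "\<And>x y. d x y = d y x"
      "\<And>x y z. d x z \<le> d x y + d y z"
    and V_d: "\<And>n x y. V n x y \<Longrightarrow> d x y < (1/2)^n"
    and d_V: "\<And>n x y. d x y < (1/2)^(Suc n) \<Longrightarrow> V n x y"
  proof (rule pseudometric_of_entourages[of V])
    show "V n x w" if "V (Suc n) x y" "V (Suc n) y z" "V (Suc n) z w" for n x y z w
      using that near_triple[of x y z w n] near_trans[of x y z n] near_trans[of x y w n]
        near_trans[of x z w n] near_Suc unfolding V_def by blast
  qed (auto simp: V_def intro: near_sym)
  have V_near: "V n x y \<longleftrightarrow> near n x y" if "x \<in> ?G" "y \<in> ?G" for n x y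
    using that near_refl by (auto simp: V_def)
  have small: "\<exists>n. (1/2::real)^n < r" if "0 < r" for r
    using that by (intro real_arch_pow_inv) auto
  have d0: "d x y = 0 \<longleftrightarrow> ?\<pi> x = ?\<pi> y" if xy: "x \<in> ?G" "y \<in> ?G" for x y
  proof
    assume "d x y = 0"
    then have "V n x y" for n using d_V[of x y n] by simp
    then show "?\<pi> x = ?\<pi> y" using xy V_near coset_eq_iff by blast
  next
    assume "?\<pi> x = ?\<pi> y"
    then have "d x y < (1/2)^n" for n using xy V_d V_near coset_eq_iff by blast
    then have "\<not> 0 < d x y" using small[of "d x y"] by (meson less_asym)
    then show "d x y = 0" using d(1)[of x y] by linarith
  qed
  define rep where "rep A = (SOME a. a \<in> ?G \<and> ?\<pi> a = A)" for A
  have rep: "rep A \<in> ?G" "?\<pi> (rep A) = A" if "A \<in> ?M" for A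
  proof -
    have "\<exists>a. a \<in> ?G \<and> ?\<pi> a = A" using that by (auto simp: left_cosets_def)
    from someI_ex[OF this] show "rep A \<in> ?G" "?\<pi> (rep A) = A" unfolding rep_def by auto
  qed
  define D where "D A B = d (rep A) (rep B)" for A B
  interpret D: Metric_space ?M D
  proof
    show "D A B = 0 \<longleftrightarrow> A = B" if "A \<in> ?M" "B \<in> ?M" for A B
      using d0 rep that by (simp add: D_def)
    show "0 \<le> D A B" "D A B = D B A" "D A C \<le> D A B + D B C" for A B C
      unfolding D_def by (rule d)+
  qed
  have coset_in: "?\<pi> x \<in> ?M" if "x \<in> ?G" for x using that by (auto simp: left_cosets_def)
  have D_eq: "D (?\<pi> x) (?\<pi> y) = d x y" if xy: "x \<in> ?G" "y \<in> ?G" for x y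
  proof -
    have "d (rep (?\<pi> x)) x = 0" "d (rep (?\<pi> y)) y = 0"
      using d0 rep coset_in xy by blast+
    then show ?thesis
      unfolding D_def
      using d(3)[of "rep (?\<pi> x)" "rep (?\<pi> y)" x] d(3)[of x "rep (?\<pi> y)" y]
        d(3)[of x y "rep (?\<pi> x)"] d(3)[of "rep (?\<pi> x)" y "rep (?\<pi> y)"]
        d(2)[of x "rep (?\<pi> x)"] d(2)[of y "rep (?\<pi> y)"]
      by linarith
  qed
  have "openin D.mtopology Q \<longleftrightarrow> openin (quotient_topology X add core) Q" for Q
  proof -
    have "(\<exists>r>0. D.mball (?\<pi> x) r \<subseteq> Q) \<longleftrightarrow> (\<exists>n. \<forall>y\<in>?G. near n x y \<longrightarrow> ?\<pi> y \<in> Q)"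
      if x: "x \<in> ?G" for x
    proof
      assume "\<exists>r>0. D.mball (?\<pi> x) r \<subseteq> Q"
      then obtain r where r: "r > 0" "D.mball (?\<pi> x) r \<subseteq> Q" by blast
      obtain n where n: "(1/2::real)^n < r" using small r by blast
      have "?\<pi> y \<in> Q" if y: "y \<in> ?G" "near n x y" for y
      proof -
        have "d x y < r" using V_d[of n x y] V_near x y n by fastforce
        then have "?\<pi> y \<in> D.mball (?\<pi> x) r" using x y coset_in by (simp add: D_eq)
        then show ?thesis using r by blast
      qed
      then show "\<exists>n. \<forall>y\<in>?G. near n x y \<longrightarrow> ?\<pi> y \<in> Q" by blast
    next
      assume "\<exists>n. \<forall>y\<in>?G. near n x y \<longrightarrow> ?\<pi> y \<in> Q"
      then obtain n where n: "\<forall>y\<in>?G. near n x y \<longrightarrow> ?\<pi> y \<in> Q" by blast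
      have "D.mball (?\<pi> x) ((1/2)^(Suc n)) \<subseteq> Q"
      proof
        fix A assume "A \<in> D.mball (?\<pi> x) ((1/2)^(Suc n))"
        then have A: "A \<in> ?M" "D (?\<pi> x) A < (1/2)^(Suc n)" by auto
        have "d x (rep A) < (1/2)^(Suc n)" using A rep x D_eq by metis
        then have "near n x (rep A)" using d_V V_near x rep A by blast
        then show "A \<in> Q" using n rep A by metis
      qed
      then show "\<exists>r>0. D.mball (?\<pi> x) r \<subseteq> Q" by (intro exI[of _ "(1/2)^(Suc n)"]) simp
    qed
    note balls = this
    have "(\<forall>A. A \<in> Q \<longrightarrow> (\<exists>r>0. D.mball A r \<subseteq> Q)) \<longleftrightarrow>
        (\<forall>x\<in>?G. ?\<pi> x \<in> Q \<longrightarrow> (\<exists>r>0. D.mball (?\<pi> x) r \<subseteq> Q))" if "Q \<subseteq> ?M"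
      using that unfolding left_cosets_def by blast
    then show ?thesis
      unfolding D.openin_mtopology openin_quotient_iff using balls by (simp cong: conj_cong)
  qed
  then have "D.mtopology = quotient_topology X add core" by (simp add: topology_eq)
  then show ?thesis using D.metrizable_space_mtopology by metis
qed

end

text \<open>Choose \<open>W n\<close> recursively inside the member of the \<open>n\<close>-th covering that contains \<open>zero\<close>.\<close>

lemma (in strongly_topological_gyrogroup) exists_invariant_neighbourhood_chain:
  assumes sym: "\<forall>U\<in>\<U>. neg ` U = U" and complete: "strongly_countably_complete X"
  shows "\<exists>W. invariant_neighbourhood_chain X add zero neg gyr W"
proof -
  obtain \<gamma> :: "nat \<Rightarrow> 'a set set" where
    cover: "\<forall>n. (\<forall>C\<in>\<gamma> n. openin X C) \<and> \<Union>(\<gamma> n) = topspace X"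
    and inter: "\<forall>F :: nat \<Rightarrow> 'a set. decseq F \<and>
      (\<forall>n. closedin X (F n) \<and> F n \<noteq> {} \<and> (\<exists>C\<in>\<gamma> n. F n \<subseteq> C)) \<longrightarrow> (\<Inter>n. F n) \<noteq> {}"
    using complete unfolding strongly_countably_complete_def by (elim exE conjE)
  define good where "good n W \<longleftrightarrow> openin X W \<and> zero \<in> W \<and> neg ` W = W \<and>
    (\<forall>x\<in>topspace X. \<forall>y\<in>topspace X. gyr x y ` W = W) \<and> (\<exists>C\<in>\<gamma> n. W \<subseteq> C)" for n W
  have good_within: "\<exists>W. good n W \<and> W \<subseteq> N" if N: "openin X N" "zero \<in> N" for n N
  proof -
    obtain C where C: "C \<in> \<gamma> n" "zero \<in> C" using cover zero_closed by blast
    then have "openin X (N \<inter> C)" "zero \<in> N \<inter> C" using cover N by auto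
    from exists_invariant_neighbourhood[OF sym this] obtain W where W: "openin X W" "zero \<in> W"
      "W \<subseteq> N \<inter> C" "neg ` W = W" "\<forall>x\<in>topspace X. \<forall>y\<in>topspace X. gyr x y ` W = W"
      by (elim exE conjE)
    then have "good n W" unfolding good_def using C(1) by (intro conjI bexI[of _ C]) auto
    then show ?thesis using W(3) by blast
  qed
  have "\<exists>W. \<forall>n. good n (W n) \<and>
      set_add add (W (Suc n)) (set_add add (W (Suc n)) (W (Suc n))) \<subseteq> W n"
  proof (rule dependent_nat_choice)
    show "\<exists>W. good 0 W" using good_within[of "topspace X"] zero_closed by blast
  next
    fix W n assume "good n W"
    then obtain S where S: "openin X S" "zero \<in> S" "set_add add S (set_add add S S) \<subseteq> W"
      using exists_triple_sum_neighbourhood[of W] unfolding good_def by blast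
    then obtain W' where "good (Suc n) W'" "W' \<subseteq> S" using good_within by blast
    moreover have "set_add add W' (set_add add W' W') \<subseteq> set_add add S (set_add add S S)"
      using \<open>W' \<subseteq> S\<close> unfolding set_add_def by blast
    ultimately show "\<exists>W'. good (Suc n) W' \<and> set_add add W' (set_add add W' W') \<subseteq> W"
      using S by blast
  qed
  then obtain W where W: "\<And>n. good n (W n)"
    and triple: "\<And>n. set_add add (W (Suc n)) (set_add add (W (Suc n)) (W (Suc n))) \<subseteq> W n"
    by blast
  have "invariant_neighbourhood_chain X add zero neg gyr W"
  proof
    fix F :: "nat \<Rightarrow> 'a set"
    assume F: "decseq F" "\<And>n. closedin X (F n)" "\<And>n. F n \<noteq> {}" "\<And>n. F n \<subseteq> W n"
    have "\<exists>C\<in>\<gamma> n. F n \<subseteq> C" for n using W[of n] F(4)[of n] unfolding good_def by blast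
    with F(1-3) show "(\<Inter>n. F n) \<noteq> {}" by (intro inter[rule_format] conjI allI)
  qed (use W triple in \<open>auto simp: good_def\<close>)
  then show ?thesis by blast
qed

theorem theorem4p6:
  fixes X :: "'a topology"
    and add :: "'a \<Rightarrow> 'a \<Rightarrow> 'a"
    and zero :: 'a
    and neg :: "'a \<Rightarrow> 'a"
    and gyr :: "'a \<Rightarrow> 'a \<Rightarrow> 'a \<Rightarrow> 'a"
    and \<U> :: "'a set set"
  assumes "strongly_topological_gyrogroup X add zero neg gyr \<U>"
    and "\<forall>U\<in>\<U>. neg ` U = U"
    and "strongly_countably_complete X"
  shows "\<exists>P. closedin X P \<and>
             countably_compactin X P \<and>
             admissible_subgyrogroup X add zero neg gyr P \<and>
             L_subgyrogroup (topspace X) add gyr P \<and>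
             metrizable_space (quotient_topology X add P) \<and>
             closed_map X (quotient_topology X add P) (left_coset add P)"
proof -
  obtain W where "invariant_neighbourhood_chain X add zero neg gyr W"
    using strongly_topological_gyrogroup.exists_invariant_neighbourhood_chain assms by metis
  then interpret invariant_neighbourhood_chain X add zero neg gyr W .
  show ?thesis
    using closedin_core countably_compactin_core admissible_core L_subgyrogroup_core
      metrizable_quotient closed_map_coset by blast
qed

end
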